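(* Let $\mathcal{H}$ be a complex Hilbert space and let $A,B\in L(\mathcal{H})$ be such that $R(A+B)$ is closed and $R(A+B)=R(A)\dotplus R(B)$ (that is, $A$ is below $A+B$ in the left minus order). Then $$(A+B)^{\dagger}=QA^{\dagger}P+(I-Q)B^{\dagger}(I-P),$$ where $P,Q\in L(\mathcal{H})$ are idempotents with $A=P(A+B)=(A+B)Q$ that are optimal for $A$ and $B$.
   Context: $L(\mathcal{H})$ is the algebra of bounded linear operators on $\mathcal{H}$, $R(T)$ is the range of $T$, $P_T$ is the orthogonal projection onto $\overline{R(T)}$, and $\dotplus$ denotes a direct (algebraic) sum of linear subspaces (trivial intersection). $T^\dagger$ is the Moore-Penrose inverse of $T$ (bounded on $\mathcal{H}$ exactly when $R(T)$ is closed; under the hypotheses $R(A)$ and $R(B)$ are closed). Optimality: for idempotents $P,Q\in L(\mathcal{H})$ with $A=P(A+B)=(A+B)Q$, $P$ is called optimal for $A$ and $B$ if $P_AP+P_B(I-P)$ is selfadjoint, and $Q$ is called optimal for $A$ and $B$ if $P_{A^*}Q^*+P_{B^*}(I-Q^* )$ is selfadjoint. *)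

theory Defs
  imports "HOL-Analysis.Analysis"
begin

text \<open>
  Complex Hilbert spaces, layered over \<^class>\<open>real_inner\<close> so that norm and topology are those
  of the library.  The real inner product is forced to be the real part of the complex one, so
  positive definiteness of \<open>cinner\<close> and \<open>norm x = sqrt (Re (cinner x x))\<close> are inherited.
\<close>

class complex_vector = real_vector +
  fixes scaleC :: "complex \<Rightarrow> 'a \<Rightarrow> 'a" (infixr "*\<^sub>C" 75)
  assumes scaleC_add_right: "c *\<^sub>C (x + y) = c *\<^sub>C x + c *\<^sub>C y"
    and scaleC_add_left: "(c + d) *\<^sub>C x = c *\<^sub>C x + d *\<^sub>C x"
    and scaleC_scaleC: "c *\<^sub>C d *\<^sub>C x = (c * d) *\<^sub>C x"
    and scaleC_of_real: "complex_of_real r *\<^sub>C x = r *\<^sub>R x"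

text \<open>The inner product is linear in the first and conjugate-linear in the second argument.\<close>

class complex_inner = complex_vector + real_inner +
  fixes cinner :: "'a \<Rightarrow> 'a \<Rightarrow> complex"
  assumes cinner_commute: "cinner x y = cnj (cinner y x)"
    and cinner_add_left: "cinner (x + y) z = cinner x z + cinner y z"
    and cinner_scaleC_left: "cinner (c *\<^sub>C x) y = c * cinner x y"
    and Re_cinner: "Re (cinner x y) = inner x y"

class complex_hilbert = complex_inner + complete_space

instantiation complex :: complex_hilbert
begin

definition scaleC_complex :: "complex \<Rightarrow> complex \<Rightarrow> complex"
  where "scaleC_complex c x = c * x"

definition cinner_complex :: "complex \<Rightarrow> complex \<Rightarrow> complex"
  where "cinner_complex x y = x * cnj y"

instance
  by standard (auto simp: scaleC_complex_def cinner_complex_def algebra_simps inner_complex_def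
      scaleR_conv_of_real)

end

definition bounded_clinear :: "('a::complex_inner \<Rightarrow> 'a) \<Rightarrow> bool"
  where "bounded_clinear T \<longleftrightarrow> bounded_linear T \<and> (\<forall>c x. T (c *\<^sub>C x) = c *\<^sub>C T x)"

definition cadjoint :: "('a::complex_inner \<Rightarrow> 'a) \<Rightarrow> 'a \<Rightarrow> 'a"
  where "cadjoint T = (THE S. \<forall>x y. cinner (T x) y = cinner x (S y))"

definition selfadjoint :: "('a::complex_inner \<Rightarrow> 'a) \<Rightarrow> bool"
  where "selfadjoint T \<longleftrightarrow> bounded_clinear T \<and> cadjoint T = T"

definition orth_proj :: "'a::complex_inner set \<Rightarrow> 'a \<Rightarrow> 'a"
  where "orth_proj M x = (THE y. y \<in> M \<and> (\<forall>z\<in>M. cinner (x - y) z = 0))"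

definition range_proj :: "('a::complex_inner \<Rightarrow> 'a) \<Rightarrow> 'a \<Rightarrow> 'a"
  where "range_proj T = orth_proj (closure (range T))"

text \<open>
  The bounded Moore--Penrose inverse, given by the four Penrose equations.  Such an operator
  exists exactly when \<open>range T\<close> is closed; \<open>mp_inverse T\<close> is unspecified otherwise.
\<close>

definition mp_inverse :: "('a::complex_inner \<Rightarrow> 'a) \<Rightarrow> 'a \<Rightarrow> 'a"
  where "mp_inverse T = (THE X. bounded_clinear X \<and>
           T \<circ> X \<circ> T = T \<and> X \<circ> T \<circ> X = X \<and> selfadjoint (T \<circ> X) \<and> selfadjoint (X \<circ> T))"

definition is_direct_sum :: "'a::complex_vector set \<Rightarrow> 'a set \<Rightarrow> 'a set \<Rightarrow> bool"
  where "is_direct_sum S M N \<longleftrightarrow> S = {u + v |u v. u \<in> M \<and> v \<in> N} \<and> M \<inter> N = {0}"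

definition idempotent_op :: "('a::complex_inner \<Rightarrow> 'a) \<Rightarrow> bool"
  where "idempotent_op P \<longleftrightarrow> bounded_clinear P \<and> P \<circ> P = P"

definition optimal_left :: "('a::complex_inner \<Rightarrow> 'a) \<Rightarrow> ('a \<Rightarrow> 'a) \<Rightarrow> ('a \<Rightarrow> 'a) \<Rightarrow> bool"
  where "optimal_left A B P \<longleftrightarrow>
    idempotent_op P \<and> A = P \<circ> (\<lambda>x. A x + B x) \<and>
    selfadjoint (\<lambda>x. range_proj A (P x) + range_proj B (x - P x))"

definition optimal_right :: "('a::complex_inner \<Rightarrow> 'a) \<Rightarrow> ('a \<Rightarrow> 'a) \<Rightarrow> ('a \<Rightarrow> 'a) \<Rightarrow> bool"
  where "optimal_right A B Q \<longleftrightarrow>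
    idempotent_op Q \<and> A = (\<lambda>x. A x + B x) \<circ> Q \<and>
    selfadjoint (\<lambda>x. range_proj (cadjoint A) (cadjoint Q x) +
                     range_proj (cadjoint B) (x - cadjoint Q x))"

end

theory Submission
  imports Defs
begin

text \<open>
  Write \<open>T = A + B\<close>.  Since \<open>PA = A\<close>, \<open>PB = 0\<close>, \<open>AQ = A\<close> and \<open>BQ = 0\<close>, the candidate
  \<open>Z = Q A\<^sup>\<dagger> P + (I - Q) B\<^sup>\<dagger> (I - P)\<close> satisfies the algebraic Penrose equations, and
  \<open>T Z = A A\<^sup>\<dagger> P + B B\<^sup>\<dagger> (I - P)\<close> and \<open>(Z T)\<^sup>* = A\<^sup>\<dagger> A Q\<^sup>* + B\<^sup>\<dagger> B (I - Q\<^sup>*)\<close> are exactly the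
  operators whose selfadjointness is the optimality of \<open>P\<close> and \<open>Q\<close>.  Optimal \<open>P\<close> and \<open>Q\<close> exist:
  \<open>A T\<^sup>\<dagger>\<close> and \<open>T\<^sup>\<dagger> A\<close> will do.  The ranges of \<open>A\<close> and \<open>B\<close> are closed, being the fixed point sets
  of \<open>A T\<^sup>\<dagger>\<close> and \<open>B T\<^sup>\<dagger>\<close>.
\<close>

subsection \<open>Hilbert space preliminaries\<close>

text \<open>The projection theorem: a sequence in \<open>M\<close> minimising the distance to
  \<open>x\<close> is Cauchy by the parallelogram law, and minimality of its limit forces
  orthogonality.\<close>

lemma closed_subspace_orthogonal_decomposition:
  fixes M :: "'a::{real_inner,complete_space} set"
  assumes "subspace M" "closed M"
  shows "\<exists>y\<in>M. \<forall>z\<in>M. inner (x - y) z = 0"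
proof -
  define d where "d = infdist x M"
  have ne: "M \<noteq> {}" using assms(1) subspace_0 by blast
  have d0: "0 \<le> d" by (simp add: d_def infdist_nonneg)
  have lower: "d \<le> norm (x - y)" if "y \<in> M" for y
    using infdist_le[OF that, of x] by (simp add: d_def dist_norm)
  have "\<exists>y\<in>M. norm (x - y) < d + 1 / Suc n" for n
  proof (rule ccontr)
    assume "\<not> ?thesis"
    then have "d + 1 / Suc n \<le> infdist x M"
      unfolding infdist_notempty[OF ne] by (intro cINF_greatest[OF ne]) (force simp: dist_norm)
    then show False by (simp add: d_def)
  qed
  then obtain y where yM: "\<And>n. y n \<in> M" and y: "\<And>n. norm (x - y n) < d + 1 / Suc n"
    by metis
  \<comment> \<open>Midpoints stay in \<open>M\<close>, so the sum in the parallelogram identity has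
    norm at least \<open>2 * d\<close>.\<close>
  have par: "(norm (y m - y n))\<^sup>2 \<le> 2 * (norm (x - y m))\<^sup>2 + 2 * (norm (x - y n))\<^sup>2 - 4 * d\<^sup>2" for m n
  proof -
    have "(1/2) *\<^sub>R (y m + y n) \<in> M"
      using assms(1) yM by (simp add: subspace_add subspace_scale)
    from lower[OF this] have "2 * d \<le> norm (2 *\<^sub>R (x - (1/2) *\<^sub>R (y m + y n)))"
      by simp
    also have "2 *\<^sub>R (x - (1/2) *\<^sub>R (y m + y n)) = (x - y m) + (x - y n)"
      by (simp add: algebra_simps scaleR_2)
    finally have "(2 * d)\<^sup>2 \<le> (norm ((x - y m) + (x - y n)))\<^sup>2"
      using d0 by (intro power_mono) auto
    moreover have "(norm ((x - y m) + (x - y n)))\<^sup>2 + (norm (y m - y n))\<^sup>2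
       = 2 * (norm (x - y m))\<^sup>2 + 2 * (norm (x - y n))\<^sup>2"
      by (simp add: power2_norm_eq_inner inner_simps algebra_simps inner_commute)
    ultimately show ?thesis by (simp add: power2_eq_square)
  qed
  have lim: "(\<lambda>n. norm (x - y n)) \<longlonglongrightarrow> d"
  proof (rule tendsto_sandwich)
    show "\<forall>\<^sub>F n in sequentially. d \<le> norm (x - y n)" using lower yM by simp
    show "\<forall>\<^sub>F n in sequentially. norm (x - y n) \<le> d + 1 / Suc n" using y by (simp add: less_imp_le)
    show "(\<lambda>n. d + 1 / Suc n) \<longlonglongrightarrow> d"
      using tendsto_add[OF tendsto_const LIMSEQ_Suc[OF lim_1_over_n]] by simp
  qed auto
  have "Cauchy y"
  proof (rule CauchyI)
    fix e :: real assume "e > 0"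
    have "(\<lambda>n. 4 * (norm (x - y n))\<^sup>2) \<longlonglongrightarrow> 4 * d\<^sup>2"
      by (intro tendsto_intros lim)
    \<comment> \<open>Half the sum of this bound at \<open>m\<close> and at \<open>n\<close> is
      \<open>4 * d\<^sup>2 + e\<^sup>2\<close>, so \<open>par\<close> leaves less than
      \<open>e\<^sup>2\<close>.\<close>
    then have "\<forall>\<^sub>F n in sequentially. 4 * (norm (x - y n))\<^sup>2 < 4 * d\<^sup>2 + e\<^sup>2"
      by (rule order_tendstoD(2)) (use \<open>e > 0\<close> in simp)
    then obtain N where N: "\<And>n. n \<ge> N \<Longrightarrow> 4 * (norm (x - y n))\<^sup>2 < 4 * d\<^sup>2 + e\<^sup>2"
      by (auto simp: eventually_sequentially)
    have "norm (y m - y n) < e" if "m \<ge> N" "n \<ge> N" for m n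
    proof (rule power2_less_imp_less)
      show "(norm (y m - y n))\<^sup>2 < e\<^sup>2"
        using par[of m n] N[OF that(1)] N[OF that(2)] by linarith
    qed (use \<open>e > 0\<close> in simp)
    then show "\<exists>M. \<forall>m\<ge>M. \<forall>n\<ge>M. norm (y m - y n) < e" by blast
  qed
  then obtain l where l: "y \<longlonglongrightarrow> l" by (auto simp: Cauchy_convergent_iff convergent_def)
  have lM: "l \<in> M" using closed_sequentially[OF assms(2)] yM l by blast
  have "(\<lambda>n. norm (x - y n)) \<longlonglongrightarrow> norm (x - l)" by (intro tendsto_intros l)
  then have dl: "norm (x - l) = d" using lim LIMSEQ_unique by blast
  have "inner (x - l) z = 0" if z: "z \<in> M" for z
  proof (cases "z = 0")
    case False
    \<comment> \<open>The coefficient of the projection of \<open>x - l\<close> onto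
      \<open>z\<close>, where the squared distance along \<open>z\<close> is smallest.\<close>
    define t where "t = inner (x - l) z / inner z z"
    have "l + t *\<^sub>R z \<in> M" using lM z assms(1) by (simp add: subspace_add subspace_scale)
    then have "(norm (x - l))\<^sup>2 \<le> (norm (x - (l + t *\<^sub>R z)))\<^sup>2"
      using lower dl d0 by (intro power_mono) auto
    also have "\<dots> = (norm (x - l))\<^sup>2 - 2 * t * inner (x - l) z + t\<^sup>2 * inner z z"
      unfolding power2_norm_eq_inner by (simp add: inner_simps algebra_simps inner_commute power2_eq_square)
    also have "t\<^sup>2 * inner z z = t * inner (x - l) z"
      using False by (simp add: t_def power2_eq_square)
    finally have "t * inner (x - l) z \<le> 0" by simp
    then have "t * inner (x - l) z * inner z z \<le> 0" by (simp add: mult_nonpos_nonneg)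
    also have "t * inner (x - l) z * inner z z = (inner (x - l) z)\<^sup>2"
      using False by (simp add: t_def power2_eq_square)
    finally show ?thesis by simp
  qed simp
  then show ?thesis using lM by blast
qed

text \<open>Unless \<open>f\<close> vanishes, a vector \<open>u\<close> orthogonal to its closed
  kernel represents \<open>f\<close> after rescaling. The real version suffices,
  \<open>inner\<close> being the real part of \<open>cinner\<close>.\<close>

lemma riesz_representation:
  fixes f :: "'a::{real_inner,complete_space} \<Rightarrow> real"
  assumes "bounded_linear f"
  shows "\<exists>y. \<forall>x. f x = inner x y"
proof (cases "\<forall>x. f x = 0")
  case True
  then show ?thesis by (intro exI[of _ 0]) simp
next
  case False
  interpret f: bounded_linear f by fact
  let ?K = "{x. f x = 0}"
  from False obtain a where a: "f a \<noteq> 0" by blast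
  have "closed ?K" by (intro closed_Collect_eq continuous_intros f.continuous_on)
  moreover have "subspace ?K" by (auto simp: subspace_def f.add f.scaleR)
  ultimately obtain p where p: "f p = 0" "\<And>z. f z = 0 \<Longrightarrow> inner (a - p) z = 0"
    using closed_subspace_orthogonal_decomposition[of ?K a] by auto
  define u where "u = a - p"
  have fu: "f u \<noteq> 0" using a p by (simp add: u_def f.diff)
  then have "u \<noteq> 0" using f.zero by metis
  have "f x = inner x ((f u / inner u u) *\<^sub>R u)" for x
  proof -
    have "inner u (x - (f x / f u) *\<^sub>R u) = 0"
      unfolding u_def by (rule p(2)) (use fu in \<open>simp add: f.diff f.scaleR flip: u_def\<close>)
    then show ?thesis using fu \<open>u \<noteq> 0\<close> by (simp add: inner_simps field_simps inner_commute)
  qed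
  then show ?thesis by blast
qed

text \<open>By Baire, one of the closed sets \<open>F n\<close> covering the space contains a ball,
  and a common bound on a ball bounds the norms.\<close>

lemma uniform_boundedness_inner:
  fixes S :: "'a::{real_inner,complete_space} set"
  assumes "\<And>y. \<exists>K. \<forall>a\<in>S. \<bar>inner a y\<bar> \<le> K"
  shows "\<exists>K. \<forall>a\<in>S. norm a \<le> K"
proof -
  define F where "F n = {y. \<forall>a\<in>S. \<bar>inner a y\<bar> \<le> real n}" for n
  have clF: "closed (F n)" for n
  proof -
    have "F n = (\<Inter>a\<in>S. {y. \<bar>inner a y\<bar> \<le> real n})" by (auto simp: F_def)
    then show ?thesis by (auto intro!: closed_INT closed_Collect_le continuous_intros)
  qed
  have "\<exists>n. y \<in> F n" for y
  proof -
    obtain K where K: "\<And>a. a \<in> S \<Longrightarrow> \<bar>inner a y\<bar> \<le> K" using assms by blast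
    moreover obtain n where "K \<le> real n" using real_arch_simple by blast
    ultimately have "y \<in> F n" by (force simp: F_def)
    then show ?thesis ..
  qed
  then have "\<Union>(range F) = UNIV" by blast
  moreover have "euclidean interior_of \<Union>(range F) = {}"
    if "\<And>n. interior (F n) = {}"
    using that clF completely_metrizable_space_euclidean
    by (intro Baire_category_alt) auto
  ultimately have "\<exists>n. interior (F n) \<noteq> {}" 
    by (metis UNIV_not_empty interior_of_topspace topspace_euclidean)
  then obtain n x where "x \<in> interior (F n)" by blast
  then obtain e where e: "e > 0" "cball x e \<subseteq> F n" by (meson mem_interior_cball)
  have "norm a \<le> 2 * n / e" if a: "a \<in> S" for a
  proof (cases "a = 0")
    case False
    \<comment> \<open>Scaled to length \<open>e\<close>, so that \<open>x + h\<close> stays in the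
      ball while \<open>inner a h\<close> equals \<open>e * norm a\<close>.\<close>
    define h where "h = (e / norm a) *\<^sub>R a"
    have "norm h = e" using False e by (simp add: h_def)
    then have "x + h \<in> F n" "x \<in> F n" using e by (auto simp: subset_iff dist_norm)
    then have "\<bar>inner a (x + h)\<bar> \<le> n" "\<bar>inner a x\<bar> \<le> n" using a by (auto simp: F_def)
    then have "inner a h \<le> 2 * n" by (simp add: inner_simps)
    also have "inner a h = e * norm a" using False
      by (simp add: h_def dot_square_norm power2_eq_square)
    finally show ?thesis using e by (simp add: field_simps)
  qed (use e in simp)
  then show ?thesis by blast
qed

lemma subspace_closure:
  fixes M :: "'a::real_normed_vector set"
  assumes "subspace M"
  shows "subspace (closure M)"
proof (rule subspaceI)
  show "0 \<in> closure M" using assms closure_subset subspace_0 by blast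
  show "x + y \<in> closure M" if x: "x \<in> closure M" and y: "y \<in> closure M" for x y
  proof -
    obtain f g where "\<And>n. f n \<in> M" "f \<longlonglongrightarrow> x" "\<And>n. g n \<in> M" "g \<longlonglongrightarrow> y"
      using x y unfolding closure_sequential by blast
    then have "\<And>n. f n + g n \<in> M" "(\<lambda>n. f n + g n) \<longlonglongrightarrow> x + y"
      using assms by (auto intro: subspace_add tendsto_add)
    then show ?thesis unfolding closure_sequential by (intro exI conjI allI)
  qed
  show "c *\<^sub>R x \<in> closure M" if x: "x \<in> closure M" for x c
  proof -
    obtain f where "\<And>n. f n \<in> M" "f \<longlonglongrightarrow> x"
      using x unfolding closure_sequential by blast
    then have "\<And>n. c *\<^sub>R f n \<in> M" "(\<lambda>n. c *\<^sub>R f n) \<longlonglongrightarrow> c *\<^sub>R x"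
      using assms by (auto intro: subspace_scale tendsto_scaleR)
    then show ?thesis unfolding closure_sequential by (intro exI conjI allI)
  qed
qed

text \<open>Uniform boundedness first bounds the adjoint \<open>S\<close> from below on
  \<open>range T\<close>. Duality transfers the constant to \<open>T\<close>, since vectors
  orthogonal to the kernel of \<open>T\<close> lie in the closure of \<open>range S\<close>.\<close>

lemma closed_range_bounded_below:
  fixes T S :: "'a::{real_inner,complete_space} \<Rightarrow> 'a"
  assumes T: "bounded_linear T" and S: "bounded_linear S"
    and adj: "\<And>x y. inner (T x) y = inner x (S y)"
    and cl: "closed (range T)"
  shows "\<exists>c. \<forall>x. (\<forall>z. T z = 0 \<longrightarrow> inner x z = 0) \<longrightarrow> norm x \<le> c * norm (T x)"
proof -
  interpret T: bounded_linear T by fact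
  interpret S: bounded_linear S by fact
  have subT: "subspace (range T)" and subS: "subspace (range S)"
    using subspace_UNIV T.linear_axioms S.linear_axioms linear_subspace_image by blast+
  \<comment> \<open>Projecting \<open>y\<close> onto \<open>range T\<close> changes neither
    \<open>S y\<close> nor the pairing with \<open>range T\<close>; hence \<open>S\<close> attains
    its whole range on \<open>range T\<close>.\<close>
  have proj: "\<exists>y'\<in>range T. S y' = S y \<and> (\<forall>z. inner y' (T z) = inner y (T z))" for y
  proof -
    obtain y' where y': "y' \<in> range T" "\<And>z. inner (y - y') (T z) = 0"
      using closed_subspace_orthogonal_decomposition[OF subT cl, of y] by blast
    have "inner x (S (y - y')) = 0" for x
      using y'(2)[of x] adj by (metis inner_commute)
    then have "S (y - y') = 0" by (metis inner_eq_zero_iff)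
    then show ?thesis using y' by (auto simp: S.diff inner_simps)
  qed
  \<comment> \<open>\<open>U\<close> is weakly bounded: \<open>y \<bullet> T x = S y \<bullet> x\<close>, and functionals on the range suffice.\<close>
  define U where "U = {y \<in> range T. norm (S y) \<le> 1}"
  have "\<exists>K. \<forall>y\<in>U. \<bar>inner y w\<bar> \<le> K" for w
  proof -
    obtain x where x: "\<And>z. inner (T x) (T z) = inner w (T z)" using proj[of w] by auto
    have "\<bar>inner y w\<bar> \<le> norm x" if yU: "y \<in> U" for y
    proof -
      have "inner y w = inner x (S y)"
      proof -
        obtain v where v: "y = T v" using yU by (force simp: U_def)
        have "inner y w = inner (T x) y" unfolding v x by (rule inner_commute)
        then show ?thesis by (simp add: adj)
      qed
      also have "\<bar>\<dots>\<bar> \<le> norm x * norm (S y)" by (rule Cauchy_Schwarz_ineq2)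
      also have "\<dots> \<le> norm x * 1" using yU by (intro mult_left_mono) (auto simp: U_def)
      finally show ?thesis by simp
    qed
    then show ?thesis by blast
  qed
  from uniform_boundedness_inner[OF this] obtain c where c: "\<And>y. y \<in> U \<Longrightarrow> norm y \<le> c" by blast
  have Sbelow: "norm y \<le> c * norm (S y)" if y: "y \<in> range T" for y
  proof (cases "S y = 0")
    case True
    obtain v where "y = T v" using y by blast
    then have "inner y y = inner v (S y)" by (simp only: adj)
    then show ?thesis using True by simp
  next
    case False
    have "(1 / norm (S y)) *\<^sub>R y \<in> U"
      using False y subT by (simp add: U_def S.scaleR subspace_scale)
    from c[OF this] False show ?thesis by (simp add: field_simps)
  qed
  have "norm x \<le> c * norm (T x)" if x: "\<And>z. T z = 0 \<Longrightarrow> inner x z = 0" for x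
  proof -
    \<comment> \<open>\<open>x\<close> equals its projection \<open>p\<close> onto
      \<open>closure (range S)\<close>: the difference is orthogonal to \<open>range S\<close>,
      hence in the kernel of \<open>T\<close>, hence orthogonal to \<open>x\<close> as well as to
      \<open>p\<close>.\<close>
    have "subspace (closure (range S))" by (rule subspace_closure[OF subS])
    then obtain p where p: "p \<in> closure (range S)"
        "\<And>z. z \<in> closure (range S) \<Longrightarrow> inner (x - p) z = 0"
      using closed_subspace_orthogonal_decomposition[of "closure (range S)" x] by auto
    have "inner (T (x - p)) y = 0" for y
      using p(2)[of "S y"] closure_subset adj by (metis rangeI subsetD)
    then have "T (x - p) = 0" by (metis inner_eq_zero_iff)
    then have "inner x (x - p) = 0" by (rule x)
    moreover have "inner p (x - p) = 0" using p(2)[OF p(1)] by (simp add: inner_commute)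
    ultimately have "inner (x - p) (x - p) = 0" by (simp only: inner_diff_left)
    then have xcl: "x \<in> closure (range S)" using p(1) by simp
    have "inner x s \<le> c * norm (T x) * norm s" if "s \<in> range S" for s
    proof -
      obtain y where y: "y \<in> range T" "s = S y" using \<open>s \<in> range S\<close> proj by (metis imageE)
      have "inner x s = inner (T x) y" by (simp add: y adj)
      also have "\<dots> \<le> norm (T x) * norm y" by (rule norm_cauchy_schwarz)
      also have "\<dots> \<le> norm (T x) * (c * norm (S y))"
        by (intro mult_left_mono Sbelow y) auto
      finally show ?thesis by (simp add: y ac_simps)
    qed
    \<comment> \<open>The estimate is a closed condition on \<open>s\<close>, so it extends to the
      closure and may be read at \<open>s = x\<close>.\<close>
    then have "range S \<subseteq> {s. inner x s \<le> c * norm (T x) * norm s}" by blast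
    moreover have "closed {s. inner x s \<le> c * norm (T x) * norm s}"
      by (intro closed_Collect_le continuous_intros)
    ultimately have "inner x x \<le> c * norm (T x) * norm x"
      using xcl closure_minimal by blast
    then have "norm x * norm x \<le> (c * norm (T x)) * norm x"
      by (simp add: dot_square_norm power2_eq_square)
    \<comment> \<open>This settles \<open>x = 0\<close>, where \<open>norm x\<close> cannot be
      cancelled.\<close>
    moreover have "0 \<le> c * norm (T x)"
    proof -
      have "0 \<in> U" using subT by (simp add: U_def subspace_0)
      from c[OF this] show ?thesis by simp
    qed
    ultimately show ?thesis
      by (cases "x = 0") (auto dest: mult_right_le_imp_le)
  qed
  then show ?thesis by blast
qed

subsection \<open>Complex linear operators and adjoints\<close>

lemma bounded_clinear_linear: "bounded_clinear T \<Longrightarrow> bounded_linear T"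
  by (simp add: bounded_clinear_def)

lemma bounded_clinear_simps:
  assumes "bounded_clinear T"
  shows "T (x + y) = T x + T y" "T (x - y) = T x - T y" "T 0 = 0" "T (c *\<^sub>C x) = c *\<^sub>C T x"
proof -
  interpret bounded_linear T using assms by (rule bounded_clinear_linear)
  show "T (x + y) = T x + T y" "T (x - y) = T x - T y" "T 0 = 0" "T (c *\<^sub>C x) = c *\<^sub>C T x"
    using assms by (auto simp: add diff zero bounded_clinear_def)
qed

lemma scaleC_diff_right: "c *\<^sub>C (x - y) = c *\<^sub>C x - c *\<^sub>C (y::'a::complex_vector)"
  using scaleC_add_right[of c "x - y" y] by (simp add: algebra_simps)

lemma bounded_clinear_comp:
  assumes "bounded_clinear S" "bounded_clinear T" shows "bounded_clinear (\<lambda>x. S (T x))"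
  using assms bounded_linear_compose[of S T] by (auto simp: bounded_clinear_def)

lemma bounded_clinear_add:
  assumes "bounded_clinear S" "bounded_clinear T" shows "bounded_clinear (\<lambda>x. S x + T x)"
  using assms by (auto simp: bounded_clinear_def scaleC_add_right intro: bounded_linear_add)

lemma bounded_clinear_diff:
  assumes "bounded_clinear S" "bounded_clinear T" shows "bounded_clinear (\<lambda>x. S x - T x)"
  using assms by (auto simp: bounded_clinear_def scaleC_diff_right intro: bounded_linear_sub)

lemma bounded_clinear_ident: "bounded_clinear (\<lambda>x. x)"
  by (auto simp: bounded_clinear_def)

lemma Im_cinner: "Im (cinner x y) = - inner (\<i> *\<^sub>C x) y"
  by (simp add: cinner_scaleC_left flip: Re_cinner)

text \<open>Up to sign, the imaginary part of \<open>cinner x y\<close> is the real inner product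
  with \<open>\<i> *\<^sub>C x\<close>, so two real identities give a complex one.\<close>

lemma cinner_eqI:
  assumes "inner x y = inner u v" "inner (\<i> *\<^sub>C x) y = inner (\<i> *\<^sub>C u) v"
  shows "cinner x y = cinner u v"
  by (rule complex_eqI) (simp_all add: Re_cinner Im_cinner assms)

lemma cinner_zero_left: "cinner 0 x = 0"
  using cinner_add_left[of 0 0 x] by simp

lemma inner_scaleC_commute:
  fixes x y :: "'a::complex_inner"
  shows "inner (c *\<^sub>C x) y = inner x (cnj c *\<^sub>C y)"
proof -
  have "cinner (c *\<^sub>C x) y = cinner x (cnj c *\<^sub>C y)"
    by (metis cinner_commute cinner_scaleC_left complex_cnj_cnj complex_cnj_mult)
  then show ?thesis by (metis Re_cinner)
qed

lemma inner_ext: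
  fixes x y :: "'a::real_inner"
  assumes "\<And>z. inner z x = inner z y"
  shows "x = y"
proof -
  have "inner (x - y) (x - y) = 0" by (simp add: inner_diff_right assms)
  then show ?thesis by simp
qed

text \<open>Complex linearity of \<open>T\<close> lets the real adjoint identity be used at
  \<open>\<i> *\<^sub>C x\<close> too, which yields the complex one. Adjoints can thus be handled
  through \<open>inner\<close> alone.\<close>

lemma cadjoint_eqI:
  assumes T: "bounded_clinear T" and S: "\<And>x y. inner (T x) y = inner x (S y)"
  shows "cadjoint T = S"
  unfolding cadjoint_def
proof (rule the_equality)
  show "\<forall>x y. cinner (T x) y = cinner x (S y)"
    using S by (metis T bounded_clinear_simps(4) cinner_eqI)
  fix S' assume "\<forall>x y. cinner (T x) y = cinner x (S' y)"
  then show "S' = S" using S by (metis Re_cinner inner_ext ext)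
qed

lemma cadjoint_works:
  fixes T :: "'a::complex_hilbert \<Rightarrow> 'a"
  assumes T: "bounded_clinear T"
  shows "inner (T x) y = inner x (cadjoint T y)"
proof -
  have "\<exists>z. \<forall>x. inner (T x) y = inner x z" for y
    by (rule riesz_representation) (intro bounded_linear_inner_left_comp bounded_clinear_linear T)
  then obtain S where S: "\<And>x y. inner (T x) y = inner x (S y)" by metis
  with cadjoint_eqI[OF T S] show ?thesis by simp
qed

text \<open>Linearity follows by testing against every vector. The square of
  \<open>norm (S y)\<close> is \<open>inner (T (S y)) y\<close>, so \<open>S\<close> inherits the
  bound \<open>K\<close> of \<open>T\<close>.\<close>

lemma bounded_clinear_adjoint:
  assumes T: "bounded_clinear T" and adj: "\<And>x y. inner (T x) y = inner x (S y)"
  shows "bounded_clinear S"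
proof -
  obtain K where K: "\<And>x. norm (T x) \<le> norm x * K" and "0 \<le> K"
    using bounded_linear.nonneg_bounded[OF bounded_clinear_linear[OF T]] by blast
  have "norm (S y) \<le> norm y * K" for y
  proof -
    have "norm (S y) * norm (S y) = inner (T (S y)) y"
      by (simp add: adj dot_square_norm power2_eq_square)
    also have "\<dots> \<le> norm (T (S y)) * norm y" by (rule norm_cauchy_schwarz)
    also have "\<dots> \<le> (norm (S y) * K) * norm y" by (intro mult_right_mono K) auto
    finally have "norm (S y) * norm (S y) \<le> norm (S y) * (norm y * K)" by (simp add: ac_simps)
    then show ?thesis using \<open>0 \<le> K\<close>
      by (cases "S y = 0") (auto dest: mult_left_le_imp_le)
  qed
  moreover have "S (x + y) = S x + S y" for x y
    by (rule inner_ext) (metis adj inner_add_right)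
  moreover have "S (r *\<^sub>R x) = r *\<^sub>R S x" for r x
    by (rule inner_ext) (metis adj inner_scaleR_right)
  moreover have "S (c *\<^sub>C x) = c *\<^sub>C S x" for c x
  proof (rule inner_ext)
    fix z
    have "inner z (S (c *\<^sub>C x)) = inner (cnj c *\<^sub>C T z) x"
      by (simp add: inner_scaleC_commute flip: adj)
    also have "\<dots> = inner z (c *\<^sub>C S x)"
      by (simp add: adj inner_scaleC_commute flip: bounded_clinear_simps(4)[OF T])
    finally show "inner z (S (c *\<^sub>C x)) = inner z (c *\<^sub>C S x)" .
  qed
  ultimately show ?thesis
    unfolding bounded_clinear_def by (blast intro: bounded_linear_intro)
qed

lemma bounded_clinear_cadjoint:
  fixes T :: "'a::complex_hilbert \<Rightarrow> 'a"
  shows "bounded_clinear T \<Longrightarrow> bounded_clinear (cadjoint T)"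
  by (rule bounded_clinear_adjoint) (auto intro: cadjoint_works)

lemma cadjoint_comp:
  fixes S T :: "'a::complex_hilbert \<Rightarrow> 'a"
  assumes "bounded_clinear S" "bounded_clinear T"
  shows "cadjoint (\<lambda>x. S (T x)) = (\<lambda>x. cadjoint T (cadjoint S x))"
  by (rule cadjoint_eqI[OF bounded_clinear_comp[OF assms]])
    (simp add: cadjoint_works[OF assms(1)] cadjoint_works[OF assms(2)])

lemma cadjoint_add:
  fixes S T :: "'a::complex_hilbert \<Rightarrow> 'a"
  assumes "bounded_clinear S" "bounded_clinear T"
  shows "cadjoint (\<lambda>x. S x + T x) = (\<lambda>x. cadjoint S x + cadjoint T x)"
  by (rule cadjoint_eqI[OF bounded_clinear_add[OF assms]])
    (simp add: inner_add_left inner_add_right cadjoint_works[OF assms(1)] cadjoint_works[OF assms(2)])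

lemma selfadjoint_iff:
  fixes T :: "'a::complex_hilbert \<Rightarrow> 'a"
  shows "selfadjoint T \<longleftrightarrow> bounded_clinear T \<and> (\<forall>x y. inner (T x) y = inner x (T y))"
proof (intro iffI conjI allI; (elim conjE)?)
  show "inner (T x) y = inner x (T y)" if "selfadjoint T" for x y
    using cadjoint_works[of T x y] that by (simp add: selfadjoint_def)
  show "selfadjoint T" if "bounded_clinear T" "\<forall>x y. inner (T x) y = inner x (T y)"
    using that cadjoint_eqI[of T T] by (simp add: selfadjoint_def)
qed (simp add: selfadjoint_def)

lemma selfadjoint_bounded_clinear: "selfadjoint T \<Longrightarrow> bounded_clinear T"
  by (simp add: selfadjoint_def)

text \<open>Taking adjoints reverses the order of the selfadjoint factors in the hypothesis.\<close>

lemma selfadjoint_absorb: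
  fixes E F :: "'a::complex_hilbert \<Rightarrow> 'a"
  assumes E: "selfadjoint E" and F: "selfadjoint F" and "\<And>x. F (E x) = E x"
  shows "E (F x) = E x"
proof (rule inner_ext)
  fix z
  have "inner z (E (F x)) = inner (F (E z)) x" using E F by (simp add: selfadjoint_iff)
  also have "\<dots> = inner z (E x)" using E assms(3) by (simp add: selfadjoint_iff)
  finally show "inner z (E (F x)) = inner z (E x)" .
qed

lemma selfadjoint_absorb':
  fixes E F :: "'a::complex_hilbert \<Rightarrow> 'a"
  assumes E: "selfadjoint E" and F: "selfadjoint F" and "\<And>x. E (F x) = E x"
  shows "F (E x) = E x"
proof (rule inner_ext)
  fix z
  have "inner z (F (E x)) = inner (E (F z)) x" using E F by (simp add: selfadjoint_iff)
  also have "\<dots> = inner z (E x)" using E assms(3) by (simp add: selfadjoint_iff)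
  finally show "inner z (F (E x)) = inner z (E x)" .
qed

subsection \<open>Moore--Penrose inverses\<close>

text \<open>The condition inside \<open>mp_inverse\<close> as a predicate, so that existence and
  uniqueness can be treated apart from the definite description.\<close>

definition is_mp_inverse :: "('a::complex_inner \<Rightarrow> 'a) \<Rightarrow> ('a \<Rightarrow> 'a) \<Rightarrow> bool"
  where "is_mp_inverse T X \<longleftrightarrow> bounded_clinear X \<and>
    T \<circ> X \<circ> T = T \<and> X \<circ> T \<circ> X = X \<and> selfadjoint (T \<circ> X) \<and> selfadjoint (X \<circ> T)"

lemma is_mp_inverseD:
  assumes "is_mp_inverse T X"
  shows "bounded_clinear X" "T (X (T x)) = T x" "X (T (X x)) = X x"
    "selfadjoint (\<lambda>x. T (X x))" "selfadjoint (\<lambda>x. X (T x))"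
  using assms by (auto simp: is_mp_inverse_def o_def fun_eq_iff)

text \<open>\<open>T X\<close> and \<open>T Y\<close> are both the orthogonal projection onto
  \<open>range T\<close>, and \<open>X T\<close> and \<open>Y T\<close> agree likewise; then
  \<open>X = X T X = X T Y = Y T Y = Y\<close>.\<close>

lemma is_mp_inverse_unique:
  fixes T :: "'a::complex_hilbert \<Rightarrow> 'a"
  assumes X: "is_mp_inverse T X" and Y: "is_mp_inverse T Y"
  shows "X = Y"
proof
  fix x
  note X = is_mp_inverseD[OF X] and Y = is_mp_inverseD[OF Y]
  have "T (X (T (Y x))) = T (X x)"
    by (rule selfadjoint_absorb[OF X(4) Y(4)]) (rule Y(2))
  then have 1: "T (X x) = T (Y x)" by (simp add: X(2))
  have 2: "X (T z) = Y (T z)" for z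
  proof -
    have "Y (T (X (T z))) = X (T z)"
      by (rule selfadjoint_absorb'[OF X(5) Y(5)]) (simp add: Y(2))
    then show ?thesis by (simp add: X(2))
  qed
  have "X x = X (T (Y x))" using 1 X(3) by metis
  then show "X x = Y x" using 2 Y(3) by simp
qed

lemma mp_inverse_eqI:
  fixes T :: "'a::complex_hilbert \<Rightarrow> 'a"
  assumes "is_mp_inverse T X" shows "mp_inverse T = X"
  unfolding mp_inverse_def is_mp_inverse_def[symmetric]
  by (rule the_equality, rule assms, rule is_mp_inverse_unique[OF _ assms])

text \<open>The inverse sends \<open>y\<close> to its least squares solution of minimal norm: the
  vector orthogonal to the kernel of \<open>T\<close> whose image is the projection of
  \<open>y\<close> onto \<open>range T\<close>. The lower bound on \<open>T\<close> makes this map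
  bounded.\<close>

lemma mp_inverse_works:
  fixes T :: "'a::complex_hilbert \<Rightarrow> 'a"
  assumes T: "bounded_clinear T" and cl: "closed (range T)"
  shows "is_mp_inverse T (mp_inverse T)"
proof -
  interpret T: bounded_linear T using T by (rule bounded_clinear_linear)
  have adj: "inner (T x) y = inner x (cadjoint T y)" for x y using T by (rule cadjoint_works)
  obtain c where c: "\<And>x. (\<And>z. T z = 0 \<Longrightarrow> inner x z = 0) \<Longrightarrow> norm x \<le> c * norm (T x)"
    using closed_range_bounded_below[OF bounded_clinear_linear[OF T]
        bounded_clinear_linear[OF bounded_clinear_cadjoint[OF T]] adj cl] by blast
  let ?N = "{z. T z = 0}"
  have N: "subspace ?N" "closed ?N"
    by (auto simp: subspace_def T.add T.scaleR intro!: closed_Collect_eq continuous_intros T.continuous_on)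
  have R: "subspace (range T)"
    by (rule linear_subspace_image[OF T.linear_axioms subspace_UNIV])
  have "\<exists>x. (\<forall>z. T z = 0 \<longrightarrow> inner x z = 0) \<and> (\<forall>z. inner (y - T x) (T z) = 0)" for y
  proof -
    obtain w where w: "\<And>z. inner (y - T w) (T z) = 0"
      using closed_subspace_orthogonal_decomposition[OF R cl, of y] by auto
    obtain p where p: "T p = 0" "\<And>z. T z = 0 \<Longrightarrow> inner (w - p) z = 0"
      using closed_subspace_orthogonal_decomposition[OF N, of w] by auto
    have "T (w - p) = T w" by (simp add: T.diff p)
    then show ?thesis using w p by (intro exI[of _ "w - p"]) simp
  qed
  then obtain X where X1: "\<And>y z. T z = 0 \<Longrightarrow> inner (X y) z = 0"
    and X2: "\<And>y z. inner (y - T (X y)) (T z) = 0" by metis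
  \<comment> \<open>The difference of two candidates lies in the kernel of \<open>T\<close> and is
    orthogonal to it. This uniqueness yields \<open>XTX\<close>, additivity and homogeneity.\<close>
  have Xeq: "X y = x" if "\<And>z. T z = 0 \<Longrightarrow> inner x z = 0" "\<And>z. inner (y - T x) (T z) = 0" for y x
  proof -
    have "inner (T (X y - x)) (T z) = inner (y - T x) (T z) - inner (y - T (X y)) (T z)" for z
      by (simp add: T.diff inner_diff_left)
    then have "inner (T (X y - x)) (T z) = 0" for z by (simp add: that(2) X2)
    then have 0: "T (X y - x) = 0" by (metis inner_eq_zero_iff)
    then have "inner (X y - x) (X y - x) = 0"
      using X1[OF 0, of y] that(1)[OF 0] by (simp add: inner_diff_left)
    then show ?thesis by simp
  qed
  have TXT: "T (X (T x)) = T x" for x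
  proof -
    have "inner (T x - T (X (T x))) (T (x - X (T x))) = 0" by (rule X2)
    then show ?thesis by (simp add: T.diff)
  qed
  have TX: "inner (T (X x)) y = inner x (T (X y))" for x y
    using X2[of x "X y"] X2[of y "X x"] by (simp add: inner_diff_left inner_diff_right inner_commute)
  have XT: "inner (X (T x)) y = inner x (X (T y))" for x y
  proof -
    have "T (x - X (T x)) = 0" "T (y - X (T y)) = 0" by (simp_all add: T.diff TXT)
    from X1[OF this(1), of "T y"] X1[OF this(2), of "T x"] show ?thesis
      by (simp add: inner_diff_right inner_commute)
  qed
  have XTX: "X (T (X y)) = X y" for y by (rule Xeq) (simp_all add: X1)
  have add: "X (x + y) = X x + X y" for x y
  proof (rule Xeq)
    have "inner (x + y - T (X x + X y)) (T z) = inner (x - T (X x)) (T z) + inner (y - T (X y)) (T z)" for z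
      by (simp add: T.add inner_simps)
    then show "inner (x + y - T (X x + X y)) (T z) = 0" for z by (simp add: X2)
  qed (simp add: X1 inner_add_left)
  have scaleC: "X (c *\<^sub>C x) = c *\<^sub>C X x" for c x
  proof (rule Xeq)
    note Tc = bounded_clinear_simps(4)[OF T]
    show "inner (c *\<^sub>C X x) z = 0" if "T z = 0" for z
    proof -
      have "T (cnj c *\<^sub>C z) = cnj c *\<^sub>C T z" by (rule Tc)
      also have "cnj c *\<^sub>C T z = 0"
        unfolding that using bounded_clinear_simps(3)[OF T] scaleC_diff_right[of "cnj c" 0 "0::'a"] by simp
      finally show ?thesis by (simp add: inner_scaleC_commute X1)
    qed
    show "inner (c *\<^sub>C x - T (c *\<^sub>C X x)) (T z) = 0" for z
      using X2[of x "cnj c *\<^sub>C z"]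
      by (simp only: Tc inner_scaleC_commute flip: scaleC_diff_right)
  qed
  \<comment> \<open>\<open>X y\<close> is orthogonal to the kernel, so \<open>c\<close> applies, and
    the projection \<open>T (X y)\<close> is no longer than \<open>y\<close>.\<close>
  have bound: "norm (X y) \<le> norm y * \<bar>c\<bar>" for y
  proof -
    have "norm (X y) \<le> c * norm (T (X y))" by (rule c) (rule X1)
    also have "\<dots> \<le> \<bar>c\<bar> * norm (T (X y))" by (intro mult_right_mono) auto
    also have "\<dots> \<le> \<bar>c\<bar> * norm y"
    proof (rule mult_left_mono)
      have "norm (T (X y)) * norm (T (X y)) = inner y (T (X y))"
        using X2[of y "X y"] by (simp add: inner_diff_left dot_square_norm power2_eq_square)
      also have "\<dots> \<le> norm y * norm (T (X y))" by (rule norm_cauchy_schwarz)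
      finally show "norm (T (X y)) \<le> norm y"
        by (cases "T (X y) = 0") (auto dest: mult_right_le_imp_le)
    qed simp
    finally show ?thesis by (simp add: mult.commute)
  qed
  have "bounded_linear X"
    by (rule bounded_linear_intro[OF add _ bound]) (metis scaleC scaleC_of_real)
  then have X: "bounded_clinear X" by (simp add: bounded_clinear_def scaleC)
  have "is_mp_inverse T X"
    using X bounded_clinear_comp[OF T X] bounded_clinear_comp[OF X T]
    by (simp add: is_mp_inverse_def o_def TXT XTX selfadjoint_iff TX XT)
  then show ?thesis by (simp add: mp_inverse_eqI)
qed

section \<open>Closed ranges and the orthogonal projections onto them\<close>

lemma closed_fixed_points:
  assumes "bounded_clinear E"
  shows "closed {x. E x = x}"
  using assms by (intro closed_Collect_eq continuous_intros linear_continuous_on bounded_clinear_linear)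

lemma orth_proj_range:
  fixes E :: "'a::complex_hilbert \<Rightarrow> 'a"
  assumes E: "selfadjoint E" and idem: "\<And>x. E (E x) = E x"
  shows "orth_proj (range E) = E"
proof
  fix x
  have lin: "bounded_clinear E" using E by (simp add: selfadjoint_iff)
  have adj: "cinner (E u) v = cinner u (E v)" for u v
    by (rule cinner_eqI) (use E in \<open>simp_all add: selfadjoint_iff flip: bounded_clinear_simps(4)[OF lin]\<close>)
  \<comment> \<open>One identity for both halves: \<open>u = x\<close> gives orthogonality, and
    \<open>v = E x - E u\<close> forces a competitor \<open>E u\<close> to equal
    \<open>E x\<close>.\<close>
  have orth: "cinner (x - E u) (E v) = cinner (E x - E u) v" for u v
    by (simp add: idem bounded_clinear_simps[OF lin] flip: adj)
  show "orth_proj (range E) x = E x"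
    unfolding orth_proj_def
  proof (rule the_equality)
    show "E x \<in> range E \<and> (\<forall>z\<in>range E. cinner (x - E x) z = 0)"
      by (auto simp: orth cinner_zero_left)
    fix y assume y: "y \<in> range E \<and> (\<forall>z\<in>range E. cinner (x - y) z = 0)"
    then obtain u where u: "y = E u" by blast
    then have "cinner (E x - E u) (E x - E u) = 0" using y by (simp flip: orth)
    then have "inner (E x - E u) (E x - E u) = 0" by (metis Re_cinner zero_complex.simps(1))
    then show "y = E x" by (simp add: u)
  qed
qed

text \<open>The hypotheses identify \<open>range S\<close> with the fixed points of
  \<open>E\<close>, a closed set, so the closure in \<open>range_proj\<close> changes
  nothing.\<close>

lemma range_proj_eq:
  fixes E S :: "'a::complex_hilbert \<Rightarrow> 'a"
  assumes E: "selfadjoint E" and ES: "\<And>x. E (S x) = S x" and SE: "\<And>x. E x \<in> range S"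
  shows "range_proj S = E"
proof -
  have ran: "range S = {x. E x = x}"
  proof
    show "{x. E x = x} \<subseteq> range S" using SE by (metis (mono_tags) mem_Collect_eq subsetI)
  qed (auto simp: ES)
  have idem: "E (E x) = E x" for x using SE[of x] ES by auto
  have "range E = {x. E x = x}"
  proof
    show "{x. E x = x} \<subseteq> range E" by (metis (mono_tags) mem_Collect_eq rangeI subsetI)
  qed (auto simp: idem)
  then show ?thesis
    using closed_fixed_points[OF selfadjoint_bounded_clinear[OF E]] orth_proj_range[OF E idem]
    by (simp add: range_proj_def ran)
qed

lemma range_proj_mp_inverse:
  fixes T :: "'a::complex_hilbert \<Rightarrow> 'a"
  assumes "is_mp_inverse T X"
  shows "range_proj T = (\<lambda>x. T (X x))"
  using is_mp_inverseD[OF assms] by (intro range_proj_eq) auto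

text \<open>Adjoints reverse products, so the Penrose equations are preserved and the selfadjoint
  products \<open>T X\<close> and \<open>X T\<close> change places.\<close>

lemma is_mp_inverse_cadjoint:
  fixes T :: "'a::complex_hilbert \<Rightarrow> 'a"
  assumes T: "bounded_clinear T" and mp: "is_mp_inverse T X"
  shows "is_mp_inverse (cadjoint T) (cadjoint X)"
    and "(\<lambda>x. cadjoint T (cadjoint X x)) = (\<lambda>x. X (T x))"
proof -
  note X = is_mp_inverseD[OF mp]
  have 1: "(\<lambda>x. cadjoint T (cadjoint X x)) = (\<lambda>x. X (T x))"
    using X(5) cadjoint_comp[OF X(1) T] by (simp add: selfadjoint_def)
  have 2: "(\<lambda>x. cadjoint X (cadjoint T x)) = (\<lambda>x. T (X x))"
    using X(4) cadjoint_comp[OF T X(1)] by (simp add: selfadjoint_def)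
  show "(\<lambda>x. cadjoint T (cadjoint X x)) = (\<lambda>x. X (T x))" by (rule 1)
  have "cadjoint T = cadjoint (\<lambda>x. T (X (T x)))" by (simp add: X(2))
  also have "\<dots> = (\<lambda>x. cadjoint T (cadjoint X (cadjoint T x)))"
    using cadjoint_comp[OF T bounded_clinear_comp[OF X(1) T]] cadjoint_comp[OF X(1) T] by simp
  finally have 3: "(\<lambda>x. cadjoint T (cadjoint X (cadjoint T x))) = cadjoint T" ..
  have "cadjoint X = cadjoint (\<lambda>x. X (T (X x)))" by (simp add: X(3))
  also have "\<dots> = (\<lambda>x. cadjoint X (cadjoint T (cadjoint X x)))"
    using cadjoint_comp[OF X(1) bounded_clinear_comp[OF T X(1)]] cadjoint_comp[OF T X(1)] by simp
  finally have 4: "(\<lambda>x. cadjoint X (cadjoint T (cadjoint X x))) = cadjoint X" ..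
  show "is_mp_inverse (cadjoint T) (cadjoint X)"
    unfolding is_mp_inverse_def o_def
    by (intro conjI 3 4 bounded_clinear_cadjoint X(1)) (simp_all only: 1 2 X)
qed

text \<open>This rewrites the projections in \<open>optimal_right\<close> as products without
  adjoints.\<close>

lemma range_proj_cadjoint:
  fixes T :: "'a::complex_hilbert \<Rightarrow> 'a"
  assumes "bounded_clinear T" "is_mp_inverse T X"
  shows "range_proj (cadjoint T) = (\<lambda>x. X (T x))"
  using range_proj_mp_inverse[OF is_mp_inverse_cadjoint(1)[OF assms]]
    is_mp_inverse_cadjoint(2)[OF assms] by simp

lemma mp_inverse_range:
  assumes "is_mp_inverse T X" "y \<in> range T"
  shows "T (X y) = y"
proof -
  obtain x where "y = T x" using assms(2) by blast
  then show ?thesis using is_mp_inverseD(2)[OF assms(1)] by simp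
qed

subsection \<open>Optimal idempotents\<close>

text \<open>Directness makes the \<open>A\<close>-component of a vector unique: the first two
  identities compare decompositions of one vector, and the third is their difference. Thus
  \<open>range A\<close> is the fixed point set of \<open>A X\<close>, hence closed.\<close>

lemma direct_summand_comp_mp_inverse:
  fixes A B :: "'a::complex_hilbert \<Rightarrow> 'a"
  assumes A: "bounded_clinear A" and B: "bounded_clinear B"
    and mp: "is_mp_inverse (\<lambda>x. A x + B x) X"
    and disj: "range A \<inter> range B = {0}"
    and subA: "range A \<subseteq> range (\<lambda>x. A x + B x)"
  shows "A (X (A x + B x)) = A x" "A (X (A x)) = A x" "A (X (B x)) = 0"
    "closed (range A)"
proof -
  note A_simps = bounded_clinear_simps[OF A] and B_simps = bounded_clinear_simps[OF B]
    and X_simps = bounded_clinear_simps[OF is_mp_inverseD(1)[OF mp]]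
  have eqD: "A u = A v" if "A u + B u = A v + B w" for u v w
  proof -
    have "A (u - v) = B (w - u)" using that by (simp add: A_simps B_simps algebra_simps)
    then have "A (u - v) \<in> range A \<inter> range B" by (metis IntI rangeI)
    then show ?thesis unfolding disj by (simp add: A_simps)
  qed
  show *: "A (X (A x + B x)) = A x" for x
    by (rule eqD) (rule is_mp_inverseD(2)[OF mp])
  show **: "A (X (A x)) = A x" for x
  proof (rule eqD)
    show "A (X (A x)) + B (X (A x)) = A x + B 0"
      using mp_inverse_range[OF mp, of "A x"] subA by (auto simp: B_simps)
  qed
  show "A (X (B x)) = 0"
    using *[of x] **[of x] by (simp add: A_simps X_simps)
  have "range A = {x. A (X x) = x}"
  proof
    show "{x. A (X x) = x} \<subseteq> range A" by (metis (mono_tags) mem_Collect_eq rangeI subsetI)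
  qed (auto simp: **)
  then show "closed (range A)"
    using closed_fixed_points[OF bounded_clinear_comp[OF A is_mp_inverseD(1)[OF mp]]] by simp
qed

text \<open>For \<open>P = A X\<close>, the projection onto \<open>range A\<close> fixes
  \<open>P x\<close> and that onto \<open>range B\<close> sends \<open>x - P x\<close> to
  \<open>B (X x)\<close>. The operator in \<open>optimal_left\<close> is therefore
  \<open>(A + B) X\<close>, selfadjoint by a Penrose equation.\<close>

lemma optimal_left_comp_mp_inverse:
  fixes A B :: "'a::complex_hilbert \<Rightarrow> 'a"
  assumes A: "bounded_clinear A" and B: "bounded_clinear B"
    and mp: "is_mp_inverse (\<lambda>x. A x + B x) X"
    and disj: "range A \<inter> range B = {0}"
    and subA: "range A \<subseteq> range (\<lambda>x. A x + B x)"
    and subB: "range B \<subseteq> range (\<lambda>x. A x + B x)"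
  shows "optimal_left A B (\<lambda>x. A (X x))"
proof -
  note X = is_mp_inverseD[OF mp]
  note facts_A = direct_summand_comp_mp_inverse[OF A B mp disj subA]
  have "is_mp_inverse (\<lambda>x. B x + A x) X" using mp by (simp add: add.commute)
  note facts_B = direct_summand_comp_mp_inverse[OF B A this]
  have facts_B: "B (X (B x)) = B x" "closed (range B)" for x
    using disj subB by (auto intro!: facts_B simp: add.commute Int_commute)
  note mpA = mp_inverse_works[OF A facts_A(4)] and mpB = mp_inverse_works[OF B facts_B(2)]
  have projA: "range_proj A (A x) = A x" for x
    using is_mp_inverseD(2)[OF mpA] by (simp add: range_proj_mp_inverse[OF mpA])
  have projB: "range_proj B (x - A (X x)) = B (X x)" for x
  proof -
    let ?E = "\<lambda>x. B (mp_inverse B x)"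
    note E = is_mp_inverseD[OF mpB]
    note E_simps = bounded_clinear_simps[OF selfadjoint_bounded_clinear[OF E(4)]]
    \<comment> \<open>The two arguments differ by a vector orthogonal to the range of the sum, which
      contains \<open>range B\<close>.\<close>
    have "?E (A (X x) + B (X x)) = ?E x"
    proof (rule selfadjoint_absorb[OF E(4) X(4)])
      show "A (X (?E y)) + B (X (?E y)) = ?E y" for y
        using mp_inverse_range[OF mp, of "?E y"] subB by auto
    qed
    then have "?E (A (X x)) + ?E (B (X x)) = ?E x" by (simp add: E_simps)
    then have "?E (x - A (X x)) = ?E (B (X x))" by (simp add: E_simps algebra_simps)
    then show ?thesis by (simp add: E(2) range_proj_mp_inverse[OF mpB])
  qed
  show ?thesis
    unfolding optimal_left_def idempotent_op_def
    using bounded_clinear_comp[OF A X(1)] X(4)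
    by (simp add: fun_eq_iff facts_A projA projB)
qed

text \<open>Right optimality is left optimality for the adjoint pair: its sum has inverse
  \<open>cadjoint X\<close>, and the adjoint of \<open>X A\<close> is the left candidate built from
  it.\<close>

lemma optimal_right_mp_inverse_comp:
  fixes A B :: "'a::complex_hilbert \<Rightarrow> 'a"
  assumes A: "bounded_clinear A" and B: "bounded_clinear B"
    and mp: "is_mp_inverse (\<lambda>x. A x + B x) X"
    and disj: "range A \<inter> range B = {0}"
    and subA: "range A \<subseteq> range (\<lambda>x. A x + B x)"
    and subB: "range B \<subseteq> range (\<lambda>x. A x + B x)"
  shows "optimal_right A B (\<lambda>x. X (A x))"
proof -
  note X = is_mp_inverseD[OF mp]
  let ?A = "cadjoint A" and ?B = "cadjoint B" and ?X = "cadjoint X"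
  note T = bounded_clinear_add[OF A B]
  have adjT: "cadjoint (\<lambda>x. A x + B x) = (\<lambda>x. ?A x + ?B x)" by (rule cadjoint_add[OF A B])
  note facts = direct_summand_comp_mp_inverse[OF A B mp disj subA]
  have facts_B: "B (X (A x + B x)) = B x" for x
    using is_mp_inverseD(2)[OF mp, of x] facts(1)[of x] by simp
  have AX: "A (X y) + B (X y) = y" if "y \<in> range A" for y
    using mp_inverse_range[OF mp, of y] subA that by blast
  have Q: "bounded_clinear (\<lambda>x. X (A x))" by (rule bounded_clinear_comp[OF X(1) A])
  have idem: "X (A (X (A x))) = X (A x)" for x by (simp add: facts)
  have AQ: "A x = A (X (A x)) + B (X (A x))" for x by (simp add: AX)
  have BXA: "B (X (A x)) = 0" for x using AX[of "A x"] facts(2)[of x] by simp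
  have zero: "cadjoint (\<lambda>x. 0) = (\<lambda>x. 0::'a)"
    by (rule cadjoint_eqI) (use bounded_clinear_diff[OF A A] in simp_all)
  \<comment> \<open>The adjoint of \<open>X A\<close> fixes the range of \<open>?A\<close> and
    annihilates that of \<open>?B\<close>, so these ranges meet only in zero.\<close>
  have QA: "?A (?X (?A x)) = ?A x" for x
    using cadjoint_comp[OF A Q] cadjoint_comp[OF X(1) A] by (simp add: facts fun_eq_iff)
  have QB: "?A (?X (?B x)) = 0" for x
    using cadjoint_comp[OF B Q] cadjoint_comp[OF X(1) A] by (simp add: BXA zero fun_eq_iff)
  have "optimal_left ?A ?B (\<lambda>x. ?A (?X x))"
  proof (rule optimal_left_comp_mp_inverse)
    show "bounded_clinear ?A" "bounded_clinear ?B" using A B by (auto intro: bounded_clinear_cadjoint)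
    show "is_mp_inverse (\<lambda>x. ?A x + ?B x) ?X"
      using is_mp_inverse_cadjoint(1)[OF T mp] by (simp add: adjT)
    show "range ?A \<inter> range ?B = {0}"
    proof
      show "range ?A \<inter> range ?B \<subseteq> {0}"
      proof
        fix z assume "z \<in> range ?A \<inter> range ?B"
        then obtain u v where "z = ?A u" "z = ?B v" by blast
        then show "z \<in> {0}" using QA[of u] QB[of v] by simp
      qed
      have "?A 0 = 0" "?B 0 = 0"
        using bounded_clinear_simps(3) bounded_clinear_cadjoint A B by blast+
      then show "{0} \<subseteq> range ?A \<inter> range ?B" by (metis IntI empty_subsetI insert_subset rangeI)
    qed
    \<comment> \<open>The adjoint of \<open>A = A X (A + B)\<close> exhibits each
      \<open>?A y\<close> as a value of the adjoint of the sum; the same is done below for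
      \<open>?B\<close>.\<close>
    have "?A = cadjoint (\<lambda>x. A (X (A x + B x)))" by (simp add: facts)
    also have "\<dots> = (\<lambda>x. ?A (?X (?A x)) + ?B (?X (?A x)))"
      using cadjoint_comp[OF bounded_clinear_comp[OF A X(1)] T] cadjoint_comp[OF A X(1)]
      by (simp add: adjT)
    finally have "?A y = ?A (?X (?A y)) + ?B (?X (?A y))" for y by (rule fun_cong)
    then show "range ?A \<subseteq> range (\<lambda>x. ?A x + ?B x)" by (intro image_subsetI range_eqI)
    have "?B = cadjoint (\<lambda>x. B (X (A x + B x)))" by (simp add: facts_B)
    also have "\<dots> = (\<lambda>x. ?A (?X (?B x)) + ?B (?X (?B x)))"
      using cadjoint_comp[OF bounded_clinear_comp[OF B X(1)] T] cadjoint_comp[OF B X(1)]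
      by (simp add: adjT)
    finally have "?B y = ?A (?X (?B y)) + ?B (?X (?B y))" for y by (rule fun_cong)
    then show "range ?B \<subseteq> range (\<lambda>x. ?A x + ?B x)" by (intro image_subsetI range_eqI)
  qed
  then show ?thesis
    using Q idem AQ by (simp add: optimal_right_def optimal_left_def idempotent_op_def fun_eq_iff
        cadjoint_comp[OF X(1) A])
qed

text \<open>The projections in the optimality conditions are \<open>A X\<close>, \<open>B Y\<close>,
  \<open>X A\<close> and \<open>Y B\<close>, so optimality supplies the two selfadjointness
  equations, while the idempotents separate the summands in the other two.\<close>

lemma is_mp_inverse_sum_optimal:
  fixes A B P Q :: "'a::complex_hilbert \<Rightarrow> 'a"
  assumes A: "bounded_clinear A" and B: "bounded_clinear B"
    and mpA: "is_mp_inverse A X" and mpB: "is_mp_inverse B Y"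
    and P: "optimal_left A B P" and Q: "optimal_right A B Q"
  shows "is_mp_inverse (\<lambda>x. A x + B x) (\<lambda>x. Q (X (P x)) + (Y (x - P x) - Q (Y (x - P x))))"
proof -
  note X = is_mp_inverseD[OF mpA] and Y = is_mp_inverseD[OF mpB]
  have linP: "bounded_clinear P" and linQ: "bounded_clinear Q"
    using P Q unfolding optimal_left_def optimal_right_def idempotent_op_def by blast+
  note lin = bounded_clinear_simps[OF A] bounded_clinear_simps[OF B] bounded_clinear_simps[OF linP]
    bounded_clinear_simps[OF linQ] bounded_clinear_simps[OF X(1)] bounded_clinear_simps[OF Y(1)]
  have P': "P \<circ> P = P" "A = P \<circ> (\<lambda>x. A x + B x)"
    using P unfolding optimal_left_def idempotent_op_def by blast+
  have PP: "P (P x) = P x" and PT: "P (A x + B x) = A x" for x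
    using fun_cong[OF P'(1), of x] fun_cong[OF P'(2)[symmetric], of x] unfolding o_def by blast+
  have PA: "P (A x) = A x" for x using PP[of "A x + B x"] by (simp only: PT)
  have PB: "P (B x) = 0" for x using PT[of x] by (simp add: lin PA)
  have Q': "Q \<circ> Q = Q" "A = (\<lambda>x. A x + B x) \<circ> Q"
    using Q unfolding optimal_right_def idempotent_op_def by blast+
  have QQ: "Q (Q x) = Q x" and TQ: "A (Q x) + B (Q x) = A x" for x
    using fun_cong[OF Q'(1), of x] fun_cong[OF Q'(2)[symmetric], of x] unfolding o_def by blast+
  \<comment> \<open>Evaluating \<open>TQ\<close> at \<open>Q x\<close> and at \<open>x\<close> gives
    the same left side.\<close>
  have AQ: "A (Q x) = A x" for x using TQ[of "Q x"] TQ[of x] by (simp only: QQ)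
  have BQ: "B (Q x) = 0" for x using TQ[of x] by (simp add: AQ)
  let ?Z = "\<lambda>x. Q (X (P x)) + (Y (x - P x) - Q (Y (x - P x)))"
  have linZ: "bounded_clinear ?Z"
  proof -
    note QXP = bounded_clinear_comp[OF linQ bounded_clinear_comp[OF X(1) linP]]
      and YP = bounded_clinear_comp[OF Y(1) bounded_clinear_diff[OF bounded_clinear_ident linP]]
    show ?thesis
      by (rule bounded_clinear_add[OF QXP bounded_clinear_diff[OF YP bounded_clinear_comp[OF linQ YP]]])
  qed
  have TZ: "A (?Z x) + B (?Z x) = A (X (P x)) + B (Y (x - P x))" for x
    by (simp only: lin AQ BQ) simp
  have ZT: "?Z (A x + B x) = Q (X (A x)) + (Y (B x) - Q (Y (B x)))" for x
    by (simp only: PT) (simp add: lin)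
  have TZT: "A (?Z (A x + B x)) + B (?Z (A x + B x)) = A x + B x" for x
    by (rule trans[OF TZ]) (simp only: PT add_diff_cancel_left' X(2) Y(2))
  \<comment> \<open>By \<open>TZ\<close>, the sum applied after \<open>?Z\<close> has the form
    \<open>A u + B v\<close>, which \<open>P\<close> and its complement split into the two
    summands.\<close>
  have PAB: "P (A u + B v) = A u" for u v by (simp add: lin PA PB)
  have ZTZ: "?Z (A (?Z x) + B (?Z x)) = ?Z x" for x
    unfolding TZ PAB add_diff_cancel_left' X(3) Y(3) ..
  have saTZ: "selfadjoint (\<lambda>x. A (?Z x) + B (?Z x))"
    using P unfolding TZ optimal_left_def range_proj_mp_inverse[OF mpA] range_proj_mp_inverse[OF mpB]
    by blast
  \<comment> \<open>The adjoint of \<open>?Z\<close> after the sum, and the operator that right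
    optimality makes selfadjoint; it therefore equals that composite.\<close>
  let ?W = "\<lambda>x. X (A (cadjoint Q x)) + Y (B (x - cadjoint Q x))"
  have saW: "selfadjoint ?W"
    using Q unfolding optimal_right_def range_proj_cadjoint[OF A mpA] range_proj_cadjoint[OF B mpB]
    by blast
  have "inner (Q (X (A u)) + (Y (B u) - Q (Y (B u)))) v = inner u (?W v)" for u v
  proof -
    have "inner (X (A s)) t = inner s (X (A t))" "inner (Y (B s)) t = inner s (Y (B t))" for s t
      using X(5) Y(5) by (simp_all add: selfadjoint_iff)
    then show ?thesis
      by (simp add: inner_add_left inner_diff_left inner_add_right inner_diff_right
          cadjoint_works[OF linQ] lin)
  qed
  then have "cadjoint ?W = (\<lambda>u. Q (X (A u)) + (Y (B u) - Q (Y (B u))))"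
    using saW by (intro cadjoint_eqI) (simp_all add: selfadjoint_bounded_clinear inner_commute)
  then have "?W = (\<lambda>u. Q (X (A u)) + (Y (B u) - Q (Y (B u))))"
    using saW by (simp add: selfadjoint_def)
  then have saZT: "selfadjoint (\<lambda>x. ?Z (A x + B x))"
    unfolding ZT using saW by simp
  show ?thesis
    unfolding is_mp_inverse_def o_def TZT ZTZ using linZ saTZ saZT by simp
qed

theorem corollary4p3:
  fixes A B :: "'a::complex_hilbert \<Rightarrow> 'a"
  assumes "bounded_clinear A" and "bounded_clinear B"
    and "closed (range (\<lambda>x. A x + B x))"
    and "is_direct_sum (range (\<lambda>x. A x + B x)) (range A) (range B)"
  shows "(\<exists>P Q. optimal_left A B P \<and> optimal_right A B Q) \<and>
    (\<forall>P Q. optimal_left A B P \<and> optimal_right A B Q \<longrightarrow>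
       mp_inverse (\<lambda>x. A x + B x) =
         (\<lambda>x. Q (mp_inverse A (P x)) +
              (mp_inverse B (x - P x) - Q (mp_inverse B (x - P x)))))"
proof -
  note A = assms(1) and B = assms(2)
  note mp = mp_inverse_works[OF bounded_clinear_add[OF A B] assms(3)]
  have disj: "range A \<inter> range B = {0}"
    and sum: "range (\<lambda>x. A x + B x) = {u + v |u v. u \<in> range A \<and> v \<in> range B}"
    using assms(4) by (simp_all add: is_direct_sum_def)
  have zero: "0 \<in> range A" "0 \<in> range B" using disj by auto
  have subA: "range A \<subseteq> range (\<lambda>x. A x + B x)"
    unfolding sum using zero(2) by (metis (mono_tags, lifting) add.right_neutral mem_Collect_eq subsetI)
  have subB: "range B \<subseteq> range (\<lambda>x. A x + B x)"
    unfolding sum using zero(1) by (metis (mono_tags, lifting) add.left_neutral mem_Collect_eq subsetI)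
  \<comment> \<open>Closed ranges make \<open>mp_inverse A\<close> and \<open>mp_inverse B\<close>
    genuine inverses; for \<open>B\<close> the two operators exchange roles.\<close>
  have "closed (range A)"
    by (rule direct_summand_comp_mp_inverse(4)[OF A B mp disj subA])
  moreover have "closed (range B)"
    using mp disj subB
    by (intro direct_summand_comp_mp_inverse(4)[OF B A]) (simp_all add: add.commute Int_commute)
  ultimately have "is_mp_inverse A (mp_inverse A)" "is_mp_inverse B (mp_inverse B)"
    using mp_inverse_works A B by blast+
  then have "mp_inverse (\<lambda>x. A x + B x) =
      (\<lambda>x. Q (mp_inverse A (P x)) + (mp_inverse B (x - P x) - Q (mp_inverse B (x - P x))))"
    if "optimal_left A B P" "optimal_right A B Q" for P Q
    using that A B by (intro mp_inverse_eqI is_mp_inverse_sum_optimal)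
  then show ?thesis
    using optimal_left_comp_mp_inverse[OF A B mp disj subA subB]
      optimal_right_mp_inverse_comp[OF A B mp disj subA subB] by blast
qed

end
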